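(* For all integers $k\geq 3$ and $h\geq 2$, the tree $T^+_{k,h}$ is not a generated monoid graph.
   Context: All monoids are finite. The perfect $k$-ary tree $T_{k,h}$ of height $h$ is the rooted tree in which the root has $k$ neighbors, every non-leaf vertex has exactly $k$ successors (neighbors further from the root than itself), and all leaves are at distance exactly $h$ from the root. $T^+_{k,h}$ is the tree obtained from $T_{k,h}$ by adding one extra leaf at distance $h$ from the root (i.e. attaching a new leaf to one vertex at distance $h-1$ from the root). For a monoid $M$ and $C\subseteq M$, $\underline{\mathrm{Cay}}(M,C)$ is the simple undirected graph with vertex set $M$ in which distinct $x,y$ are adjacent if and only if $y=xc$ or $x=yc$ for some $c\in C$. A generated monoid graph is a graph isomorphic to $\underline{\mathrm{Cay}}(M,C)$ for some monoid $M$ and some $C\subseteq M$ with $M=\langle C\rangle$ (i.e. $C$ generates $M$ as a monoid). *)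

theory Defs
  imports "HOL.Hull" "HOL-Algebra.Group" "Graph_Theory.Graph_Theory"
begin

text \<open>
  Simple undirected graphs are symmetric loop-free pair digraphs (locale \<open>pair_graph\<close>): an edge
  \<open>{x, y}\<close> is the pair of arcs \<open>(x, y)\<close>, \<open>(y, x)\<close>.
\<close>

text \<open>
  Vertices of the perfect tree are words over \<open>{0..<k}\<close> of length at most \<open>h\<close>. The root is the
  empty word, the distance of a word from the root is its length, and the successors of
  \<open>xs\<close> are its one-letter extensions.
\<close>

definition perfect_tree :: "nat \<Rightarrow> nat \<Rightarrow> nat list pair_pre_digraph" where
  "perfect_tree k h =
    (let V = {xs. set xs \<subseteq> {..<k} \<and> length xs \<le> h}
     in \<lparr> pverts = V,
          parcs = {(xs, ys) \<in> V \<times> V. \<exists>i. ys = xs @ [i] \<or> xs = ys @ [i]} \<rparr>)"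

text \<open>
  The extra leaf is attached to the vertex \<open>v\<close>. Since the letter \<open>k\<close> is not in the alphabet,
  \<open>v @ [k]\<close> is a new vertex. The intended use is for vertices \<open>v\<close> with \<open>length v = h - 1\<close>, for
  which the result is (up to isomorphism) independent of \<open>v\<close>.
\<close>

definition perfect_tree_plus :: "nat \<Rightarrow> nat \<Rightarrow> nat list \<Rightarrow> nat list pair_pre_digraph" where
  "perfect_tree_plus k h v =
    \<lparr> pverts = insert (v @ [k]) (pverts (perfect_tree k h)),
      parcs = parcs (perfect_tree k h) \<union> {(v, v @ [k]), (v @ [k], v)} \<rparr>"

definition cayley_graph :: "'m monoid \<Rightarrow> 'm set \<Rightarrow> 'm pair_pre_digraph" where
  "cayley_graph M C =
    \<lparr> pverts = carrier M,
      parcs = {(x, y) \<in> carrier M \<times> carrier M.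
                 x \<noteq> y \<and> (\<exists>c\<in>C. y = x \<otimes>\<^bsub>M\<^esub> c \<or> x = y \<otimes>\<^bsub>M\<^esub> c)} \<rparr>"

definition monoid_span :: "'m monoid \<Rightarrow> 'm set \<Rightarrow> 'm set" where
  "monoid_span M C = (\<lambda>H. submonoid H M) hull C"

text \<open>
  HOL cannot quantify existentially over types, so the type in which the monoid lives is a
  parameter. A statement that a graph is not a generated monoid graph is to be made for arbitrary
  \<open>'m\<close>.
\<close>

definition generated_monoid_graph :: "'m itself \<Rightarrow> 'v pair_pre_digraph \<Rightarrow> bool" where
  "generated_monoid_graph _ G \<longleftrightarrow>
    (\<exists>(M :: 'm monoid) C. monoid M \<and> finite (carrier M) \<and> C \<subseteq> carrier M \<and>
       carrier M = monoid_span M C \<and>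
       digraph_iso (with_proj G) (with_proj (cayley_graph M C)))"

lemma pair_graph_perfect_tree: "pair_graph (perfect_tree k h)"
proof -
  let ?V = "{xs. set xs \<subseteq> {..<k} \<and> length xs \<le> h}"
  have fin: "finite ?V" by (rule finite_lists_length_le) simp
  have "finite (parcs (perfect_tree k h))"
    by (rule finite_subset[of _ "?V \<times> ?V"]) (use fin in \<open>auto simp: perfect_tree_def Let_def\<close>)
  then show ?thesis using fin
    by unfold_locales
      (auto simp: perfect_tree_def Let_def symmetric_def sym_def)
qed

lemma new_leaf_notin_perfect_tree: "v @ [k] \<notin> pverts (perfect_tree k h)"
  by (simp add: perfect_tree_def Let_def)

lemma pair_graph_perfect_tree_plus:
  assumes "v \<in> pverts (perfect_tree k h)"
  shows "pair_graph (perfect_tree_plus k h v)"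
proof -
  interpret T: pair_graph "perfect_tree k h" by (rule pair_graph_perfect_tree)
  show ?thesis
    using assms T.pair_finite_verts T.pair_finite_arcs T.in_arcsD1 T.in_arcsD2
      T.pair_no_loops T.arcs_symmetric
    by unfold_locales (auto simp: perfect_tree_plus_def symmetric_def sym_def)
qed

lemma pair_graph_cayley_graph:
  assumes "finite (carrier M)"
  shows "pair_graph (cayley_graph M C)"
proof -
  have "finite (parcs (cayley_graph M C))"
    by (rule finite_subset[of _ "carrier M \<times> carrier M"])
      (use assms in \<open>auto simp: cayley_graph_def\<close>)
  then show ?thesis using assms
    by unfold_locales (auto simp: cayley_graph_def symmetric_def sym_def)
qed

lemma digraph_iso_with_proj_iff:
  assumes G: "pair_wf_digraph G" and H: "pair_wf_digraph H"
  shows "digraph_iso (with_proj G) (with_proj H) \<longleftrightarrow>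
    (\<exists>f. bij_betw f (pverts G) (pverts H) \<and>
       (\<forall>x\<in>pverts G. \<forall>y\<in>pverts G. (x, y) \<in> parcs G \<longleftrightarrow> (f x, f y) \<in> parcs H))"
    (is "?L \<longleftrightarrow> ?R")
proof
  assume ?L
  then obtain \<phi> where iso: "pre_digraph.digraph_isomorphism (with_proj G) \<phi>"
    and eq: "with_proj H = app_iso \<phi> (with_proj G)"
    unfolding digraph_iso_def by auto
  let ?f = "iso_verts \<phi>"
  have ht: "iso_tail \<phi> = fst" "iso_head \<phi> = snd" "pverts H = ?f ` pverts G"
    "parcs H = iso_arcs \<phi> ` parcs G"
    using eq by (simp_all add: with_proj_def app_iso_def)
  have inj: "inj_on ?f (pverts G)"
    and ends: "\<And>a. a \<in> parcs G \<Longrightarrow> iso_arcs \<phi> a = (?f (fst a), ?f (snd a))"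
    using iso ht by (auto simp: pre_digraph.digraph_isomorphism_def prod_eq_iff)
  have arcs: "parcs H = (\<lambda>a. (?f (fst a), ?f (snd a))) ` parcs G"
    using ht(4) ends by (auto simp: image_iff)
  have "(x, y) \<in> parcs G \<longleftrightarrow> (?f x, ?f y) \<in> parcs H"
    if "x \<in> pverts G" "y \<in> pverts G" for x y
  proof
    assume "(?f x, ?f y) \<in> parcs H"
    then obtain a where a: "a \<in> parcs G" "?f x = ?f (fst a)" "?f y = ?f (snd a)"
      using arcs by auto
    then have "x = fst a" "y = snd a"
      using inj that pair_wf_digraph.arc_fst_in_verts[OF G a(1)]
        pair_wf_digraph.arc_snd_in_verts[OF G a(1)] by (auto dest: inj_onD)
    with a(1) show "(x, y) \<in> parcs G" by simp
  qed (force simp: arcs)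
  with inj ht(3) show ?R by (auto simp: bij_betw_def)
next
  assume ?R
  then obtain f where f: "bij_betw f (pverts G) (pverts H)"
    "\<And>x y. x \<in> pverts G \<Longrightarrow> y \<in> pverts G \<Longrightarrow> (x, y) \<in> parcs G \<longleftrightarrow> (f x, f y) \<in> parcs H"
    by blast
  let ?\<phi> = "\<lparr> iso_verts = f, iso_arcs = map_prod f f, iso_head = snd, iso_tail = fst \<rparr>"
  have inj: "inj_on f (pverts G)" and im: "pverts H = f ` pverts G"
    using f(1) by (auto simp: bij_betw_def)
  have sub: "parcs G \<subseteq> pverts G \<times> pverts G"
    using pair_wf_digraph.in_arcsD1[OF G] pair_wf_digraph.in_arcsD2[OF G] by auto
  have "inj_on (map_prod f f) (parcs G)"
    using map_prod_inj_on[OF inj inj] sub by (rule inj_on_subset)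
  then have "pre_digraph.digraph_isomorphism (with_proj G) ?\<phi>"
    using inj G by (auto simp: pre_digraph.digraph_isomorphism_def wf_digraph_wp_iff)
  moreover have "parcs H = map_prod f f ` parcs G"
  proof (intro equalityI subsetI)
    fix e assume e: "e \<in> parcs H"
    obtain p q where pq: "e = (p, q)" by (cases e)
    with e have "p \<in> pverts H" "q \<in> pverts H"
      using pair_wf_digraph.in_arcsD1[OF H] pair_wf_digraph.in_arcsD2[OF H] by blast+
    then obtain x y where "x \<in> pverts G" "y \<in> pverts G" "p = f x" "q = f y"
      using im by auto
    with e pq f(2) show "e \<in> map_prod f f ` parcs G" by force
  next
    fix e assume "e \<in> map_prod f f ` parcs G"
    then show "e \<in> parcs H" using sub f(2) by auto
  qed
  then have "with_proj H = app_iso ?\<phi> (with_proj G)"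
    using im by (simp add: with_proj_def app_iso_def)
  ultimately show ?L unfolding digraph_iso_def by blast
qed

end

theory Submission
  imports Defs "HOL-Library.Sublist"
begin

text \<open>
  Let \<open>r\<close> be the root and \<open>e\<close> the vertex of the unit. As \<open>C\<close> generates \<open>M\<close>, every edge is traversed
  away from \<open>e\<close> by right multiplication with some \<open>c \<in> C\<close>. If \<open>e = r\<close>, then \<open>C\<close> has at most \<open>k\<close>
  elements other than \<open>e\<close>, too few for the \<open>k + 1\<close> children of \<open>v\<close>. If \<open>e \<noteq> r\<close>, then at least
  \<open>k - 1 \<ge> 2\<close> children of \<open>r\<close> lie away from \<open>e\<close>, so one of them is \<open>r c\<close> where \<open>c \<in> C\<close> is not the
  parent of \<open>e\<close>. Descend from \<open>r c\<close> to a leaf \<open>r c d\<^sub>2 \<dots> d\<^sub>h\<close>. Left multiplication by \<open>r\<close> does not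
  increase distances, so \<open>e, c, c d\<^sub>2, \<dots>, c d\<^sub>2 \<dots> d\<^sub>h\<close> is a geodesic, which starts downwards and
  hence ends below depth \<open>h\<close>.
\<close>

section \<open>Adjacency in trees of words\<close>

definition word_adj :: "'a list \<Rightarrow> 'a list \<Rightarrow> bool" where
  "word_adj xs ys \<longleftrightarrow> (\<exists>i. ys = xs @ [i] \<or> xs = ys @ [i])"

lemma word_adj_length: "word_adj xs ys \<Longrightarrow> length ys \<le> Suc (length xs)"
  by (auto simp: word_adj_def)

lemma word_adj_enters_subtree:
  assumes "word_adj xs ys" "\<not> prefix z xs" "prefix z ys"
  shows "ys = z" "\<exists>i. z = xs @ [i]"
  using assms by (auto simp: word_adj_def)

text \<open>The extra leaf \<open>v @ [k]\<close> extends \<open>v\<close> by one letter, and no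
  vertex extends it in turn, as words of the perfect tree avoid the letter \<open>k\<close>. So it
  needs no special case from here on.\<close>

lemma parcs_perfect_tree_plus:
  assumes "v \<in> pverts (perfect_tree k h)"
  shows "parcs (perfect_tree_plus k h v) =
    {(x, y) \<in> pverts (perfect_tree_plus k h v) \<times> pverts (perfect_tree_plus k h v). word_adj x y}"
  using assms by (auto simp: perfect_tree_plus_def perfect_tree_def Let_def word_adj_def)

section \<open>Generated monoids whose graph is a tree of words\<close>

locale word_tree_cayley = monoid M for M :: "'m monoid" (structure) +
  fixes C :: "'m set" and V :: "'a list set" and f :: "'a list \<Rightarrow> 'm"
  assumes gens: "C \<subseteq> carrier M"
    and span: "carrier M = monoid_span M C"
    and prefix_closed: "xs @ [i] \<in> V \<Longrightarrow> xs \<in> V"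
    and bij: "bij_betw f V (carrier M)"
    and adj: "\<lbrakk>x \<in> V; y \<in> V\<rbrakk> \<Longrightarrow>
      word_adj x y \<longleftrightarrow> f x \<noteq> f y \<and> (\<exists>c\<in>C. f y = f x \<otimes> c \<or> f x = f y \<otimes> c)"
begin

lemma f_carrier [simp]: "x \<in> V \<Longrightarrow> f x \<in> carrier M"
  using bij by (auto simp: bij_betw_def)

lemma f_eq_iff: "\<lbrakk>x \<in> V; y \<in> V\<rbrakk> \<Longrightarrow> f x = f y \<longleftrightarrow> x = y"
  using bij by (auto simp: bij_betw_def inj_on_eq_iff)

lemma obtain_word:
  assumes "m \<in> carrier M"
  obtains x where "x \<in> V" "f x = m"
  using assms bij_betw_imp_surj_on[OF bij] by (metis imageE)

lemma right_mult_adj: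
  assumes "x \<in> V" "y \<in> V" "c \<in> C" "f y = f x \<otimes> c" "x \<noteq> y"
  shows "word_adj x y"
  using assms adj f_eq_iff by blast

text \<open>By associativity, left multiplication by \<open>m\<close> commutes with the right
  multiplications that make up the edges; it can at worst collapse an edge.\<close>

lemma left_mult_adj:
  assumes "x \<in> V" "y \<in> V" "word_adj x y" "m \<in> carrier M"
    and "x' \<in> V" "f x' = m \<otimes> f x" "y' \<in> V" "f y' = m \<otimes> f y"
  shows "x' = y' \<or> word_adj x' y'"
proof -
  obtain c where c: "c \<in> C" "f y = f x \<otimes> c \<or> f x = f y \<otimes> c"
    using adj assms(1-3) by blast
  then have "f y' = f x' \<otimes> c \<or> f x' = f y' \<otimes> c"
    using gens assms m_assoc f_carrier by (metis subsetD)
  then show ?thesis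
    using adj assms(5,7) c(1) f_eq_iff by blast
qed

lemma right_closed_carrier:
  assumes "A \<subseteq> carrier M" "\<And>a c. \<lbrakk>a \<in> A; c \<in> C\<rbrakk> \<Longrightarrow> a \<otimes> c \<in> A" "\<one> \<in> A"
  shows "A = carrier M"
proof -
  \<comment> \<open>The elements that preserve \<open>A\<close> from the right form a submonoid
    containing \<open>C\<close>, hence are all of \<open>M\<close>; they are then applied to the
    unit in \<open>A\<close>.\<close>
  let ?H = "{m \<in> carrier M. \<forall>a\<in>A. a \<otimes> m \<in> A}"
  have "submonoid ?H M"
    using assms(1) by unfold_locales (auto simp: subset_iff simp flip: m_assoc)
  moreover have "C \<subseteq> ?H"
    using assms(2) gens by auto
  ultimately have "carrier M \<subseteq> ?H"
    unfolding span monoid_span_def by (rule hull_minimal[rotated])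
  then have "\<one> \<otimes> m \<in> A" if "m \<in> carrier M" for m
    using that assms(3) by blast
  then show ?thesis
    using assms(1) by auto
qed

text \<open>The edge from \<open>w\<close> is the only way into the subtree below
  \<open>w @ [i]\<close>. If no generator used it in this direction, the elements outside the
  subtree, among them the unit, would be closed under right multiplication by \<open>C\<close> and
  so exhaust \<open>M\<close>.\<close>

lemma down_arc:
  assumes "p \<in> V" "f p = \<one>" "w @ [i] \<in> V" "\<not> prefix (w @ [i]) p"
  obtains c where "c \<in> C" "f (w @ [i]) = f w \<otimes> c"
proof (rule ccontr)
  assume "\<not> thesis"
  with that have no: "f (w @ [i]) \<noteq> f w \<otimes> c" if "c \<in> C" for c
    using that by blast
  let ?A = "f ` {x \<in> V. \<not> prefix (w @ [i]) x}"
  have "?A = carrier M"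
  proof (rule right_closed_carrier)
    show "\<one> \<in> ?A"
      using assms by (auto simp: image_iff intro: sym)
  next
    fix a c assume "a \<in> ?A" and c: "c \<in> C"
    then obtain x where x: "x \<in> V" "\<not> prefix (w @ [i]) x" "a = f x"
      by auto
    have "a \<otimes> c \<in> carrier M"
      using x c gens by auto
    then obtain y where y: "y \<in> V" "f y = a \<otimes> c"
      using obtain_word by blast
    have "\<not> prefix (w @ [i]) y"
    proof
      assume p: "prefix (w @ [i]) y"
      then have "word_adj x y"
        using right_mult_adj x y c by blast
      from word_adj_enters_subtree[OF this x(2) p] have "y = w @ [i]" "x = w"
        by auto
      then show False
        using no c x y by auto
    qed
    then show "a \<otimes> c \<in> ?A"
      using y by (auto simp: image_iff intro!: bexI[of _ y])
  qed auto
  then have "f (w @ [i]) \<in> ?A"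
    using assms(3) by simp
  then show False
    using assms(3) f_eq_iff by auto
qed

lemma generator_adj_unit:
  assumes "p \<in> V" "f p = \<one>" "c \<in> C" "c \<noteq> \<one>"
  obtains q where "q \<in> V" "f q = c" "word_adj p q"
proof -
  obtain q where q: "q \<in> V" "f q = c"
    using obtain_word assms(3) gens by blast
  moreover have "f q = f p \<otimes> c" "p \<noteq> q"
    using assms q gens by auto
  then have "word_adj p q"
    by (rule right_mult_adj[OF assms(1) q(1) assms(3)])
  ultimately show ?thesis
    using that by blast
qed

text \<open>Left multiplication by the root sends the unit to the root and, by
  \<open>left_mult_adj\<close>, lengthens no path; here it acts on the path from \<open>p\<close>
  down along \<open>s\<close>.\<close>

lemma length_left_mult_le:
  assumes "p \<in> V" "f p = \<one>" "[] \<in> V"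
  shows "\<lbrakk>p @ s \<in> V; x \<in> V; f x = f [] \<otimes> f (p @ s)\<rbrakk> \<Longrightarrow> length x \<le> length s"
proof (induction s arbitrary: x rule: rev_induct)
  case Nil
  then show ?case
    using assms f_eq_iff by auto
next
  case (snoc j s)
  have s: "p @ s \<in> V"
    using prefix_closed[of "p @ s" j] snoc.prems(1) by simp
  obtain y where y: "y \<in> V" "f y = f [] \<otimes> f (p @ s)"
    using obtain_word[of "f [] \<otimes> f (p @ s)"] s assms(3) by auto
  have "word_adj (p @ s) (p @ s @ [j])"
    by (simp add: word_adj_def)
  from left_mult_adj[OF s snoc.prems(1) this _ y snoc.prems(2,3)]
  have "y = x \<or> word_adj y x"
    using assms(3) by simp
  with snoc.IH[OF s y] show ?case
    using word_adj_length by fastforce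
qed

section \<open>The two positions of the unit\<close>

lemma unit_not_root:
  assumes "f [] = \<one>" "[] \<in> V" "v \<noteq> []"
    and root: "finite {i. [i] \<in> V}"
    and deg: "card {i. [i] \<in> V} < card {i. v @ [i] \<in> V}"
  shows False
proof -
  let ?R = "{i. [i] \<in> V}" and ?S = "{i. v @ [i] \<in> V}"
  \<comment> \<open>With the unit at the root, a generator leading from \<open>v\<close> to a child
    is itself a child of the root. Distinct children of \<open>v\<close> need distinct
    generators.\<close>
  have "\<exists>j. j \<in> ?R \<and> f (v @ [i]) = f v \<otimes> f [j]" if "i \<in> ?S" for i
  proof -
    have vi: "v @ [i] \<in> V" and v: "v \<in> V"
      using that prefix_closed by auto
    obtain c where c: "c \<in> C" "f (v @ [i]) = f v \<otimes> c"
      using down_arc[OF assms(2,1) vi] by auto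
    have "c \<noteq> \<one>"
      using c vi v f_eq_iff by auto
    then obtain q where q: "q \<in> V" "f q = c" "word_adj [] q"
      using generator_adj_unit assms c by blast
    then show ?thesis
      using c by (auto simp: word_adj_def)
  qed
  then obtain g where g: "\<And>i. i \<in> ?S \<Longrightarrow> g i \<in> ?R \<and> f (v @ [i]) = f v \<otimes> f [g i]"
    by metis
  have "inj_on g ?S"
  proof (rule inj_onI)
    fix i j assume ij: "i \<in> ?S" "j \<in> ?S" "g i = g j"
    then have "f (v @ [i]) = f (v @ [j])"
      using g by metis
    then show "i = j"
      using ij f_eq_iff by auto
  qed
  then have "card ?S \<le> card ?R"
    using g root by (intro card_inj_on_le[of g]) auto
  then show False
    using deg by simp
qed

text \<open>\<open>hd p\<close> is the child of the root towards the unit, so \<open>i\<close> and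
  \<open>i'\<close> start branches away from it. Padding with \<open>a\<close> gives each branch a
  descending path as deep as \<open>bound\<close> allows.\<close>

lemma unit_is_root:
  assumes p: "p \<in> V" "f p = \<one>" "p \<noteq> []" and nil: "[] \<in> V"
    and i: "i \<noteq> i'" "i \<noteq> hd p" "i' \<noteq> hd p"
    and deep: "i # replicate n a \<in> V" "i' # replicate n a \<in> V"
    and bound: "\<And>x. x \<in> V \<Longrightarrow> length x \<le> Suc n"
  shows False
proof -
  have sub: "j # replicate m a \<in> V" if "j # replicate n a \<in> V" "m \<le> n" for j m
    using that(2,1)
  proof (induction rule: inc_induct)
    case (step m)
    then have "(j # replicate m a) @ [a] \<in> V"
      by (simp add: replicate_append_same)
    then show ?case
      by (rule prefix_closed)
  qed
  have away: "\<not> prefix (j # xs) p" if "j \<noteq> hd p" for j xs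
    using that p(3) by (cases p) auto
  have step: "\<exists>c\<in>C. c \<noteq> \<one> \<and> f [j] = f [] \<otimes> c" if j: "j \<noteq> hd p" "j # replicate n a \<in> V" for j
  proof -
    have jV: "[j] \<in> V"
      using sub[OF j(2), of 0] by simp
    then obtain c where "c \<in> C" "f [j] = f [] \<otimes> c"
      using down_arc[OF p(1,2), of "[]" j] away[OF j(1)] by auto
    then show ?thesis
      using jV nil f_eq_iff[of "[j]" "[]"] by force
  qed
  obtain c c' where c: "c \<in> C" "c \<noteq> \<one>" "f [i] = f [] \<otimes> c"
    and c': "c' \<in> C" "c' \<noteq> \<one>" "f [i'] = f [] \<otimes> c'"
    using step i deep by metis
  have "c \<noteq> c'"
    using c c' i(1) sub[OF deep(1), of 0] sub[OF deep(2), of 0] f_eq_iff[of "[i]" "[i']"] by auto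
  obtain q where q: "q \<in> V" "f q = c" "word_adj p q"
    using generator_adj_unit[OF p(1,2) c(1,2)] by blast
  obtain q' where q': "q' \<in> V" "f q' = c'" "word_adj p q'"
    using generator_adj_unit[OF p(1,2) c'(1,2)] by blast
  \<comment> \<open>Two distinct neighbours of \<open>p\<close> cannot both be its parent.\<close>
  have "(\<exists>j. q = p @ [j]) \<or> (\<exists>j. q' = p @ [j])"
    using \<open>c \<noteq> c'\<close> q q' by (auto simp: word_adj_def)
  then obtain l j where l: "l \<noteq> hd p" "l # replicate n a \<in> V"
    and pj: "p @ [j] \<in> V" "f [l] = f [] \<otimes> f (p @ [j])"
    using q q' c c' i deep by metis
  \<comment> \<open>The generators that descend the branch \<open>l\<close> are applied in parallel
    from \<open>p @ [j]\<close>. The invariant is that this second walk stays below \<open>p\<close>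
    and is mapped to the branch by left multiplication by the root.\<close>
  have "\<exists>s. p @ s \<in> V \<and> f (l # replicate m a) = f [] \<otimes> f (p @ s)" if "m \<le> n" for m
    using that
  proof (induction m)
    case 0
    show ?case
      using pj by auto
  next
    case (Suc m)
    then obtain s where s: "p @ s \<in> V" "f (l # replicate m a) = f [] \<otimes> f (p @ s)"
      by auto
    have z: "l # replicate m a \<in> V" "(l # replicate m a) @ [a] \<in> V"
      using sub[OF l(2), of m] sub[OF l(2), of "Suc m"] Suc.prems
      by (simp_all add: replicate_append_same)
    obtain d where d: "d \<in> C" "f ((l # replicate m a) @ [a]) = f (l # replicate m a) \<otimes> d"
      using down_arc[OF p(1,2) z(2)] away[OF l(1)] by auto
    have dM: "d \<in> carrier M"
      using d gens by auto
    obtain y where y: "y \<in> V" "f y = f (p @ s) \<otimes> d"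
      using obtain_word[of "f (p @ s) \<otimes> d"] s dM by auto
    have "f (l # replicate (Suc m) a) = f [] \<otimes> f y"
      using d(2) s y dM nil by (simp add: replicate_append_same m_assoc)
    moreover have "\<exists>s'. y = p @ s'"
    proof -
      \<comment> \<open>Thus \<open>s\<close> is nonempty, and even a step to the parent ends at
        \<open>p\<close> or below it.\<close>
      have "length s \<ge> Suc m"
        using length_left_mult_le[OF p(1,2) nil s(1) z(1) s(2)] by simp
      then obtain s' b where s': "s = s' @ [b]"
        by (cases s rule: rev_cases) auto
      have "y = p @ s \<or> word_adj (p @ s) y"
        using right_mult_adj[OF s(1) y(1) d(1) y(2)] by blast
      then consider "y = p @ s" | t where "y = p @ s @ [t]" | "y = p @ s'"
        by (auto simp: word_adj_def s' simp flip: append_assoc)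
      then show ?thesis
        by cases simp_all
    qed
    ultimately show ?case
      using y(1) by auto
  qed
  from this[of n] obtain s where s: "p @ s \<in> V" "f (l # replicate n a) = f [] \<otimes> f (p @ s)"
    by auto
  have "Suc n \<le> length s"
    using length_left_mult_le[OF p(1,2) nil s(1) l(2) s(2)] by simp
  \<comment> \<open>Since \<open>p\<close> is nonempty, \<open>p @ s\<close> has length at least
    \<open>n + 2\<close>.\<close>
  then show False
    using bound[OF s(1)] p(3) by (cases p) auto
qed

end

section \<open>Application to the tree with an extra leaf\<close>

theorem proposition5p6:
  fixes k h :: nat and v :: "nat list"
  assumes "k \<ge> 3" and "h \<ge> 2"
    and "v \<in> pverts (perfect_tree k h)" and "length v = h - 1"
  shows "\<not> generated_monoid_graph TYPE('m) (perfect_tree_plus k h v)"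
proof
  let ?G = "perfect_tree_plus k h v"
  let ?V = "pverts ?G"
  have V: "?V = insert (v @ [k]) {xs. set xs \<subseteq> {..<k} \<and> length xs \<le> h}"
    by (simp add: perfect_tree_plus_def perfect_tree_def Let_def)
  have v: "set v \<subseteq> {..<k}" "v \<noteq> []"
    using assms by (auto simp: perfect_tree_def Let_def)
  assume "generated_monoid_graph TYPE('m) ?G"
  then obtain M :: "'m monoid" and C where M: "monoid M" "finite (carrier M)" "C \<subseteq> carrier M"
      "carrier M = monoid_span M C"
    and iso: "digraph_iso (with_proj ?G) (with_proj (cayley_graph M C))"
    unfolding generated_monoid_graph_def by blast
  interpret G: pair_graph ?G
    using assms(3) by (rule pair_graph_perfect_tree_plus)
  interpret H: pair_graph "cayley_graph M C"
    using M(2) by (rule pair_graph_cayley_graph)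
  obtain f where f: "bij_betw f ?V (carrier M)"
    "\<And>x y. \<lbrakk>x \<in> ?V; y \<in> ?V\<rbrakk> \<Longrightarrow> (x, y) \<in> parcs ?G \<longleftrightarrow> (f x, f y) \<in> parcs (cayley_graph M C)"
    using iso
    unfolding digraph_iso_with_proj_iff[OF G.pair_wf_digraph_axioms H.pair_wf_digraph_axioms]
    by (auto simp: cayley_graph_def)
  interpret monoid M by (rule M(1))
  interpret word_tree_cayley M C ?V f
  proof
    fix x y assume xy: "x \<in> ?V" "y \<in> ?V"
    then have "f x \<in> carrier M" "f y \<in> carrier M"
      using f(1) by (auto simp: bij_betw_def)
    then show "word_adj x y \<longleftrightarrow>
      f x \<noteq> f y \<and> (\<exists>c\<in>C. f y = f x \<otimes>\<^bsub>M\<^esub> c \<or> f x = f y \<otimes>\<^bsub>M\<^esub> c)"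
      using f(2)[OF xy] xy parcs_perfect_tree_plus[OF assms(3)]
      by (simp add: cayley_graph_def)
  next
    show "xs \<in> ?V" if "xs @ [i] \<in> ?V" for xs i
      using that v assms(4) unfolding V by auto
  qed (use M f(1) in auto)
  have nil: "[] \<in> ?V"
    by (simp add: V)
  obtain p where p: "p \<in> ?V" "f p = \<one>\<^bsub>M\<^esub>"
    using obtain_word[of "\<one>\<^bsub>M\<^esub>"] by auto
  show False
  proof (cases "p = []")
    case True
    \<comment> \<open>The extra leaf gives \<open>v\<close>, which is not the root as
      \<open>h >= 2\<close>, one child more than the root has.\<close>
    have "{i. [i] \<in> ?V} = {..<k}" "{i. v @ [i] \<in> ?V} = {..k}"
      using v assms by (auto simp: V)
    then show False
      using unit_not_root[OF _ nil v(2)] p True by simp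
  next
    case False
    \<comment> \<open>At most one of the \<open>k >= 3\<close> children of the root lies towards the
      unit.\<close>
    have "2 \<le> card ({..<k} - {hd p})"
      using assms(1) by (cases "hd p < k") auto
    then obtain I where "I \<subseteq> {..<k} - {hd p}" "card I = 2"
      by (meson obtain_subset_with_card_n)
    then obtain i i' where "i \<noteq> i'" "i \<in> {..<k} - {hd p}" "i' \<in> {..<k} - {hd p}"
      by (auto simp: card_2_iff)
    \<comment> \<open>The letter \<open>0\<close> is an arbitrary choice; what matters is that the
      path reaches the maximal depth \<open>h\<close>.\<close>
    moreover have "j # replicate (h - 1) 0 \<in> ?V" if "j < k" for j
      using that assms by (auto simp: V)
    moreover have "length x \<le> Suc (h - 1)" if "x \<in> ?V" for x
      using that assms by (auto simp: V)
    ultimately show False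
      using unit_is_root[OF p False nil, of i i' "h - 1" 0] by auto
  qed
qed

end
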